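(* If $\{\alpha_j\}_{j=0}^\infty$ is a periodic sequence of Verblunsky coefficients (that is, $\alpha_j\in\mathbb{D}$ and $\alpha_{j+p}=\alpha_j$ for all $j\ge 0$, for some positive integer $p$) so that the corresponding measure $d\mu$ satisfies $\operatorname{supp}(d\mu)=\partial\mathbb{D}$, then $\alpha_j\equiv0$.
   Context: $\mathbb{D}=\{|z|<1\}$. For a probability measure $\mu$ on $\partial\mathbb{D}$ that is not a finite combination of delta functions, $\Phi_n$ is the monic orthogonal polynomial of degree $n$ in $L^2(\partial\mathbb{D},d\mu)$ and the Verblunsky coefficients are $\alpha_n=-\overline{\Phi_{n+1}(0)}\in\mathbb{D}$, $n\ge0$. By Verblunsky's theorem, each sequence in $\mathbb{D}$ is the sequence of Verblunsky coefficients of exactly one such measure. *)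

theory Defs
  imports "HOL-Probability.Probability" "HOL-Computational_Algebra.Polynomial"
begin

definition circle_prob_measure :: "complex measure \<Rightarrow> bool" where
  "circle_prob_measure \<mu> \<longleftrightarrow>
     prob_space \<mu> \<and> sets \<mu> = sets (restrict_space borel (sphere (0::complex) 1))"

text \<open>\<open>return \<mu> z\<close> is the unit point mass at \<open>z\<close> on the measurable space of \<open>\<mu>\<close>.\<close>

definition finite_delta_combination :: "complex measure \<Rightarrow> bool" where
  "finite_delta_combination \<mu> \<longleftrightarrow>
     (\<exists>F (c :: complex \<Rightarrow> real). finite F \<and> F \<subseteq> space \<mu> \<and>
        (\<forall>A\<in>sets \<mu>. measure \<mu> A = (\<Sum>z\<in>F. c z * measure (return \<mu> z) A)))"

text \<open>The \<open>L\<^sup>2\<close> inner product of two polynomials, antilinear in the first argument.\<close>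

definition poly_inner :: "complex measure \<Rightarrow> complex poly \<Rightarrow> complex poly \<Rightarrow> complex" where
  "poly_inner \<mu> P Q = (LINT z|\<mu>. cnj (poly P z) * poly Q z)"

definition is_monic_OP :: "complex measure \<Rightarrow> nat \<Rightarrow> complex poly \<Rightarrow> bool" where
  "is_monic_OP \<mu> n P \<longleftrightarrow>
     degree P = n \<and> lead_coeff P = 1 \<and> (\<forall>j<n. poly_inner \<mu> (monom 1 j) P = 0)"

text \<open>The description is proper whenever \<open>\<mu>\<close> is a probability measure on the circle that is not
  a finite combination of point masses; see \<open>is_monic_OP_ex1\<close> below.\<close>

definition monic_OP :: "complex measure \<Rightarrow> nat \<Rightarrow> complex poly" where
  "monic_OP \<mu> n = (THE P. is_monic_OP \<mu> n P)"

definition verblunsky :: "complex measure \<Rightarrow> nat \<Rightarrow> complex" where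
  "verblunsky \<mu> n = - cnj (poly (monic_OP \<mu> (Suc n)) 0)"

definition measure_support :: "complex measure \<Rightarrow> complex set" where
  "measure_support \<mu> =
     {z \<in> space \<mu>. \<forall>U. open U \<longrightarrow> z \<in> U \<longrightarrow> emeasure \<mu> (U \<inter> space \<mu>) > 0}"

lemma circle_prob_measure_space:
  assumes "circle_prob_measure \<mu>"
  shows "space \<mu> = sphere 0 1"
  using assms sets_eq_imp_space_eq[of \<mu> "restrict_space borel (sphere (0::complex) 1)"]
  by (simp add: circle_prob_measure_def space_restrict_space)

lemma circle_prob_measure_integrable:
  fixes f :: "complex \<Rightarrow> complex"
  assumes \<mu>: "circle_prob_measure \<mu>" and f: "continuous_on UNIV f"
  shows "integrable \<mu> f"
proof -
  interpret prob_space \<mu> using \<mu> by (simp add: circle_prob_measure_def)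
  have "compact (f ` sphere 0 1)"
    using f by (intro compact_continuous_image) (auto intro: continuous_on_subset)
  then obtain B where B: "\<And>z. z \<in> sphere 0 1 \<Longrightarrow> norm (f z) \<le> B"
    by (meson bounded_iff compact_imp_bounded imageI)
  have "f \<in> borel_measurable borel"
    using f by (rule borel_measurable_continuous_onI)
  then have "f \<in> borel_measurable (restrict_space borel (sphere (0::complex) 1))"
    by (rule measurable_restrict_space1)
  then have "f \<in> borel_measurable \<mu>"
    using \<mu> measurable_cong_sets[of \<mu> "restrict_space borel (sphere (0::complex) 1)" borel borel]
    unfolding circle_prob_measure_def by blast
  then show ?thesis
    using B circle_prob_measure_space[OF \<mu>]
    by (intro integrable_const_bound[where B = B]) auto
qed

lemma poly_inner_integrable:
  assumes "circle_prob_measure \<mu>"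
  shows "integrable \<mu> (\<lambda>z. cnj (poly P z) * poly Q z)"
  by (intro circle_prob_measure_integrable[OF assms] continuous_intros)

lemma poly_inner_linear:
  assumes "circle_prob_measure \<mu>"
  shows "poly_inner \<mu> P (Q + R) = poly_inner \<mu> P Q + poly_inner \<mu> P R"
    and "poly_inner \<mu> P (Q - R) = poly_inner \<mu> P Q - poly_inner \<mu> P R"
    and "poly_inner \<mu> P (smult c Q) = c * poly_inner \<mu> P Q"
    and "poly_inner \<mu> (P + R) Q = poly_inner \<mu> P Q + poly_inner \<mu> R Q"
    and "poly_inner \<mu> (smult c P) Q = cnj c * poly_inner \<mu> P Q"
  unfolding poly_inner_def
  using poly_inner_integrable[OF assms]
  by (simp_all add: ring_distribs mult.assoc mult.left_commute)

lemma poly_inner_orthogonal_low_degree: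
  assumes \<mu>: "circle_prob_measure \<mu>"
    and orth: "\<forall>j<n. poly_inner \<mu> (monom 1 j) P = 0"
    and deg: "\<forall>j\<ge>n. coeff Q j = 0"
  shows "poly_inner \<mu> Q P = 0"
proof -
  have *: "poly_inner \<mu> (\<Sum>j\<in>J. monom (coeff Q j) j) P = 0" if "finite J" "J \<subseteq> {..<n}" for J
    using that
  proof (induction J rule: finite_induct)
    case empty
    show ?case by (simp add: poly_inner_def)
  next
    case (insert j J)
    have "poly_inner \<mu> (monom (coeff Q j) j) P = 0"
      using poly_inner_linear(5)[OF \<mu>, of "coeff Q j" "monom 1 j" P] orth insert
      by (simp add: smult_monom)
    then show ?case using insert by (simp add: poly_inner_linear[OF \<mu>])
  qed
  have "Q = (\<Sum>j<n. monom (coeff Q j) j)"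
    using deg by (auto simp: poly_eq_iff coeff_sum not_less)
  then show ?thesis using *[of "{..<n}"] by simp
qed

lemma poly_inner_self_eq_0:
  assumes \<mu>: "circle_prob_measure \<mu>" and nt: "\<not> finite_delta_combination \<mu>"
    and zero: "poly_inner \<mu> P P = 0"
  shows "P = 0"
proof (rule ccontr)
  assume P: "P \<noteq> 0"
  interpret prob_space \<mu> using \<mu> by (simp add: circle_prob_measure_def)
  have sp: "space \<mu> = sphere 0 1" by (rule circle_prob_measure_space[OF \<mu>])
  have eq: "cnj (poly P z) * poly P z = complex_of_real ((cmod (poly P z))\<^sup>2)" for z
    using complex_norm_square[of "poly P z"] by (simp add: mult.commute)
  have int: "integrable \<mu> (\<lambda>z. (cmod (poly P z))\<^sup>2)"
    using integrable_Re[OF poly_inner_integrable[OF \<mu>, of P P]]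
    by (simp only: eq Re_complex_of_real)
  have "complex_of_real (LINT z|\<mu>. (cmod (poly P z))\<^sup>2) = 0"
    using zero unfolding poly_inner_def eq by (simp only: integral_complex_of_real)
  then have "(LINT z|\<mu>. (cmod (poly P z))\<^sup>2) = 0"
    by (simp only: of_real_eq_0_iff)
  then have "AE z in \<mu>. (cmod (poly P z))\<^sup>2 = 0"
    using integral_nonneg_eq_0_iff_AE[OF int] by simp
  then have ae: "AE z in \<mu>. poly P z = 0"
    by simp
  define F where "F = {z \<in> space \<mu>. poly P z = 0}"
  have fin: "finite F" unfolding F_def using poly_roots_finite[OF P] by simp
  have sub: "F \<subseteq> space \<mu>" by (auto simp: F_def)
  have sing: "{z} \<in> sets \<mu>" if "z \<in> space \<mu>" for z
  proof -
    have "{z} = sphere 0 1 \<inter> {z}" using that sp by auto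
    then show ?thesis
      using \<mu> by (auto simp: circle_prob_measure_def sets_restrict_space image_iff
          intro!: bexI[of _ "{z}"])
  qed
  have "measure \<mu> A = (\<Sum>z\<in>F. measure \<mu> {z} * measure (return \<mu> z) A)" if A: "A \<in> sets \<mu>" for A
  proof -
    have AF: "A \<inter> F \<in> sets \<mu>"
      using sets.countable[of "A \<inter> F" \<mu>] sing fin sub by (auto intro: countable_finite)
    have "measure \<mu> A = measure \<mu> (A \<inter> F)"
      using ae A AF by (intro finite_measure_eq_AE) (auto simp: F_def dest: sets.sets_into_space)
    also have "\<dots> = (\<Sum>z\<in>A \<inter> F. measure \<mu> {z})"
      using fin sing sub by (intro finite_measure_eq_sum_singleton) auto
    also have "\<dots> = (\<Sum>z\<in>F. if z \<in> A then measure \<mu> {z} else 0)"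
      using sum.inter_restrict[OF fin, of "\<lambda>z. measure \<mu> {z}" A] by (simp only: Int_commute)
    also have "\<dots> = (\<Sum>z\<in>F. measure \<mu> {z} * measure (return \<mu> z) A)"
      using A by (intro sum.cong) (auto simp: measure_return indicator_def)
    finally show ?thesis .
  qed
  then have "finite_delta_combination \<mu>"
    unfolding finite_delta_combination_def
    using fin sub by (intro exI[of _ F] exI[of _ "\<lambda>z. measure \<mu> {z}"]) auto
  with nt show False by simp
qed

lemma poly_projection_exists:
  assumes \<mu>: "circle_prob_measure \<mu>" and nt: "\<not> finite_delta_combination \<mu>"
  shows "\<exists>Q. (\<forall>j\<ge>n. coeff Q j = 0) \<and> (\<forall>j<n. poly_inner \<mu> (monom 1 j) (P - Q) = 0)"
proof (induction n arbitrary: P)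
  case 0
  show ?case by (intro exI[of _ 0]) simp
next
  case (Suc n)
  obtain Q where Q: "\<forall>j\<ge>n. coeff Q j = 0" "\<forall>j<n. poly_inner \<mu> (monom 1 j) (P - Q) = 0"
    using Suc by blast
  obtain R where R: "\<forall>j\<ge>n. coeff R j = 0"
    "\<forall>j<n. poly_inner \<mu> (monom 1 j) (monom 1 n - R) = 0"
    using Suc by blast
  define e where "e = monom 1 n - R"
  have e1: "coeff e n = 1" using R by (simp add: e_def)
  have eR: "poly_inner \<mu> R e = 0"
    unfolding e_def by (rule poly_inner_orthogonal_low_degree[OF \<mu> R(2) R(1)])
  have "poly_inner \<mu> e e \<noteq> 0"
    using poly_inner_self_eq_0[OF \<mu> nt, of e] e1 by auto
  moreover have "poly_inner \<mu> (monom 1 n) e = poly_inner \<mu> e e"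
    using poly_inner_linear(4)[OF \<mu>, of e R e] eR by (simp add: e_def)
  ultimately have ne: "poly_inner \<mu> (monom 1 n) e \<noteq> 0" by simp
  define c where "c = poly_inner \<mu> (monom 1 n) (P - Q) / poly_inner \<mu> (monom 1 n) e"
  have "poly_inner \<mu> (monom 1 j) (P - (Q + smult c e)) = 0" if "j < Suc n" for j
  proof -
    have "poly_inner \<mu> (monom 1 j) (P - (Q + smult c e)) =
        poly_inner \<mu> (monom 1 j) (P - Q) - c * poly_inner \<mu> (monom 1 j) e"
      by (simp add: poly_inner_linear[OF \<mu>])
    then show ?thesis
      using that Q(2) R(2) ne by (cases "j = n") (auto simp: c_def e_def)
  qed
  moreover have "coeff (Q + smult c e) j = 0" if "j \<ge> Suc n" for j
    using that Q(1) R(1) by (simp add: e_def)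
  ultimately show ?case by blast
qed

lemma is_monic_OP_ex1:
  assumes \<mu>: "circle_prob_measure \<mu>" and nt: "\<not> finite_delta_combination \<mu>"
  shows "\<exists>!P. is_monic_OP \<mu> n P"
proof (rule ex_ex1I)
  obtain R where R: "\<forall>j\<ge>n. coeff R j = 0"
    "\<forall>j<n. poly_inner \<mu> (monom 1 j) (monom 1 n - R) = 0"
    using poly_projection_exists[OF assms] by blast
  have "degree (monom 1 n - R) = n"
  proof (rule antisym)
    show "degree (monom 1 n - R) \<le> n"
      using R(1) by (intro degree_le) simp
    show "n \<le> degree (monom 1 n - R)"
      using R(1) by (intro le_degree) simp
  qed
  then show "\<exists>P. is_monic_OP \<mu> n P"
    using R by (intro exI[of _ "monom 1 n - R"]) (simp add: is_monic_OP_def)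
next
  fix P Q assume P: "is_monic_OP \<mu> n P" and Q: "is_monic_OP \<mu> n Q"
  have orth: "\<forall>j<n. poly_inner \<mu> (monom 1 j) (P - Q) = 0"
    using P Q by (simp add: is_monic_OP_def poly_inner_linear[OF \<mu>])
  have "coeff (P - Q) j = 0" if "j \<ge> n" for j
    using that P Q by (cases "j = n") (auto simp: is_monic_OP_def coeff_eq_0)
  then have "poly_inner \<mu> (P - Q) (P - Q) = 0"
    by (intro poly_inner_orthogonal_low_degree[OF \<mu> orth]) simp
  then show "P = Q"
    using poly_inner_self_eq_0[OF assms, of "P - Q"] by simp
qed

lemma is_monic_OP_monic_OP:
  assumes "circle_prob_measure \<mu>" "\<not> finite_delta_combination \<mu>"
  shows "is_monic_OP \<mu> n (monic_OP \<mu> n)"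
  unfolding monic_OP_def using is_monic_OP_ex1[OF assms] by (rule theI')

end

theory Submission
  imports Defs
begin

text \<open>Let \<open>S = (1 - |\<alpha>\<^sub>0|\<^sup>2) \<cdots> (1 - |\<alpha>\<^sub>p\<^sub>-\<^sub>1|\<^sup>2)\<close>, so that \<open>\<parallel>\<Phi>\<^sub>k\<^sub>p\<parallel>\<^sup>2 = S\<^sup>k\<close>, and suppose that some
  \<open>\<alpha>\<^sub>j\<close> is nonzero, that is \<open>S < 1\<close>. The one-period transfer matrix of the monic Szego recursion has
  determinant \<open>S z\<^sup>p\<close> and a trace \<open>t(z)\<close> which is a polynomial of degree \<open>p\<close> with first and last
  coefficient 1. Its average over the \<open>p\<close>-th roots of unity is 2, so \<open>|t| > 2 \<surd>S\<close> on some arc. There the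
  matrix has an eigenvalue of modulus greater than \<open>\<surd>S\<close> by a fixed amount, and hence the
  functions \<open>|\<Phi>\<^sub>k\<^sub>p|\<^sup>2\<close> grow faster than \<open>S\<^sup>k\<close>, except at the finitely many zeros of
  \<open>\<Phi>\<^sub>p - \<Phi>\<^sub>p\<^sup>*\<close>. Since their integrals equal \<open>S\<^sup>k\<close>, a smaller arc has measure 0, so the support
  is not the whole circle.\<close>

section \<open>Growth of solutions of a second-order linear recurrence\<close>

text \<open>The characteristic roots have a product of modulus \<open>R\<^sup>2\<close>, so the
  smaller one is at most \<open>R\<close> in modulus, and the triangle inequality pushes the larger
  one up to at least \<open>R + \<epsilon>\<close>. Bounding two consecutive terms together avoids
  dividing by the difference of the roots, which may be 0.\<close>

lemma recurrence_growth:
  fixes w :: "nat \<Rightarrow> complex" and t d :: complex and R \<epsilon> :: real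
  assumes w0: "w 0 = 0" and w: "\<And>k. w (Suc (Suc k)) = t * w (Suc k) - d * w k"
    and d: "cmod d = R\<^sup>2" and R: "R \<ge> 0" and \<epsilon>: "\<epsilon> \<ge> 0" and t: "2 * R + \<epsilon> \<le> cmod t"
  shows "(R + \<epsilon>) ^ k * cmod (w 1) \<le> cmod (w (Suc k)) + R * cmod (w k)"
proof -
  \<comment> \<open>The characteristic roots; subtracting \<open>m\<close> times the previous term leaves a geometric sequence.\<close>
  have "\<exists>l m. l + m = t \<and> l * m = d \<and> cmod m \<le> cmod l"
  proof -
    define s where "s = csqrt (t\<^sup>2 - 4 * d)"
    have s: "s\<^sup>2 = t\<^sup>2 - 4 * d" by (simp add: s_def)
    have "(t + s) / 2 * ((t - s) / 2) = (t\<^sup>2 - s\<^sup>2) / 4"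
      by (simp add: power2_eq_square algebra_simps)
    then have prod: "(t + s) / 2 * ((t - s) / 2) = d" by (simp add: s)
    have sum: "(t + s) / 2 + (t - s) / 2 = t" by (simp add: field_simps)
    show ?thesis
      using prod sum by (metis add.commute mult.commute linear)
  qed
  then obtain l m where lm: "l + m = t" "l * m = d" "cmod m \<le> cmod l" by blast
  have "cmod m * cmod m \<le> cmod l * cmod m"
    using lm(3) by (simp add: mult_right_mono)
  also have "\<dots> = R\<^sup>2" using lm(2) d by (simp flip: norm_mult)
  finally have m: "cmod m \<le> R"
    using R by (metis power2_eq_square power2_le_imp_le)
  have "cmod t \<le> cmod l + cmod m" using lm(1) norm_triangle_ineq by blast
  with m t have l: "R + \<epsilon> \<le> cmod l" by simp
  have eq: "w (Suc k) - m * w k = l ^ k * w 1"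
  proof (induction k)
    case (Suc k)
    have "w (Suc (Suc k)) - m * w (Suc k) = l * (w (Suc k) - m * w k)"
      by (simp add: w lm(1,2)[symmetric] algebra_simps)
    then show ?case by (simp add: Suc)
  qed (simp add: w0)
  have "(R + \<epsilon>) ^ k * cmod (w 1) \<le> cmod l ^ k * cmod (w 1)"
    using l R \<epsilon> by (intro mult_right_mono power_mono) auto
  also have "\<dots> = cmod (w (Suc k) - m * w k)" by (simp add: eq norm_mult norm_power)
  also have "\<dots> \<le> cmod (w (Suc k)) + cmod m * cmod (w k)"
    using norm_triangle_ineq4[of "w (Suc k)" "m * w k"] by (simp add: norm_mult)
  also have "\<dots> \<le> cmod (w (Suc k)) + R * cmod (w k)"
    using m by (simp add: mult_right_mono)
  finally show ?thesis .
qed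

section \<open>Averages of a polynomial over roots of unity\<close>

lemma exists_unit_circle_large_poly:
  fixes P :: "complex poly"
  assumes p: "p > 0" and deg: "degree P \<le> p" and P0: "coeff P 0 = 1" and Pp: "coeff P p = 1"
  shows "\<exists>z\<in>sphere 0 1. 2 \<le> cmod (poly P z)"
proof (rule ccontr)
  assume neg: "\<not> ?thesis"
  define \<omega> where "\<omega> = cis (2 * pi / real p)"
  have \<omega>1: "\<omega> ^ p = 1" using p by (simp add: \<omega>_def Complex.DeMoivre)
  have norm\<omega>: "cmod \<omega> = 1" by (simp add: \<omega>_def)
  \<comment> \<open>\<open>\<omega>\<close> is a primitive root, so its power sums vanish at all
    exponents strictly between 0 and \<open>p\<close>.\<close>
  have \<omega>k: "\<omega> ^ k \<noteq> 1" if "0 < k" "k < p" for k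
  proof
    assume "\<omega> ^ k = 1"
    then have "cis (real k * (2 * pi / real p)) = 1" by (simp add: \<omega>_def Complex.DeMoivre)
    then have "cos (2 * pi * real k / real p) = 1"
      by (simp add: complex_eq_iff mult_ac)
    then obtain i :: int where "2 * pi * real k / real p = of_int i * 2 * pi"
      by (auto simp: cos_one_2pi_int)
    then have "real k = of_int i * real p" using p by (simp add: field_simps)
    then have "int k = i * int p" by (metis of_int_eq_iff of_int_mult of_int_of_nat_eq)
    then have "int p dvd int k" by simp
    then show False using that by (auto dest: dvd_imp_le)
  qed
  have sum0: "(\<Sum>j<p. (\<omega> ^ j) ^ k) = (if k = 0 \<or> k = p then of_nat p else 0)" if "k \<le> p" for k
  proof -
    have "(\<Sum>j<p. (\<omega> ^ j) ^ k) = (\<Sum>j<p. (\<omega> ^ k) ^ j)"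
      by (simp flip: power_mult add: mult.commute)
    also have "\<dots> = (if k = 0 \<or> k = p then of_nat p else 0)"
    proof (cases "k = 0 \<or> k = p")
      case False
      with that have "\<omega> ^ k \<noteq> 1" by (intro \<omega>k) auto
      moreover have "(\<omega> ^ k) ^ p = 1" by (metis \<omega>1 mult.commute power_mult power_one)
      ultimately show ?thesis using False by (simp add: geometric_sum)
    qed (auto simp: \<omega>1)
    finally show ?thesis .
  qed
  have "(\<Sum>j<p. poly P (\<omega> ^ j)) = (\<Sum>j<p. \<Sum>k\<le>p. coeff P k * (\<omega> ^ j) ^ k)"
    using deg by (intro sum.cong) (auto simp: poly_altdef intro!: sum.mono_neutral_left le_degree)
  also have "\<dots> = (\<Sum>k\<le>p. coeff P k * (\<Sum>j<p. (\<omega> ^ j) ^ k))"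
    by (subst sum.swap) (simp add: sum_distrib_left)
  \<comment> \<open>Only the two end coefficients survive the averaging; both are 1, and they are
    distinct terms because \<open>p > 0\<close>.\<close>
  also have "\<dots> = (\<Sum>k\<in>{0, p}. coeff P k * of_nat p)"
    by (intro sum.mono_neutral_cong_right) (auto simp: sum0)
  also have "\<dots> = 2 * of_nat p" using p P0 Pp by simp
  finally have "real p * 2 = cmod (\<Sum>j<p. poly P (\<omega> ^ j))" by (simp add: norm_mult)
  also have "\<dots> \<le> (\<Sum>j<p. cmod (poly P (\<omega> ^ j)))" by (rule norm_sum)
  also have "\<dots> < (\<Sum>j<p. 2)"
    using neg p norm\<omega> by (intro sum_strict_mono) (auto simp: not_le norm_power)
  finally show False by simp
qed

section \<open>Transfer matrices of the Szego recursion\<close>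

text \<open>The second component stands for the reversed polynomial. Reversal is antilinear, but
  carried along as an independent entry it makes each step linear, hence a matrix.\<close>

primrec szego_pair ::
  "(nat \<Rightarrow> complex) \<Rightarrow> complex poly \<times> complex poly \<Rightarrow> nat \<Rightarrow> complex poly \<times> complex poly" where
  "szego_pair \<alpha> uv 0 = uv"
| "szego_pair \<alpha> uv (Suc n) =
     (let (u, v) = szego_pair \<alpha> uv n
      in (pCons 0 u - smult (cnj (\<alpha> n)) v, v - smult (\<alpha> n) (pCons 0 u)))"

text \<open>The columns of the unnormalised \<open>n\<close>-step transfer matrix.\<close>

abbreviation "transfer1 \<alpha> \<equiv> szego_pair \<alpha> (1, 0)"
abbreviation "transfer2 \<alpha> \<equiv> szego_pair \<alpha> (0, 1)"

definition transfer_trace :: "(nat \<Rightarrow> complex) \<Rightarrow> nat \<Rightarrow> complex poly" where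
  "transfer_trace \<alpha> n = fst (transfer1 \<alpha> n) + snd (transfer2 \<alpha> n)"

definition transfer_det :: "(nat \<Rightarrow> complex) \<Rightarrow> nat \<Rightarrow> complex poly" where
  "transfer_det \<alpha> n =
     fst (transfer1 \<alpha> n) * snd (transfer2 \<alpha> n) - fst (transfer2 \<alpha> n) * snd (transfer1 \<alpha> n)"

text \<open>The claims about the off-diagonal entry \<open>snd\<close> carry the induction: its
  degree bound keeps \<open>fst\<close> monic, and its zero constant term removes that of
  \<open>fst\<close>.\<close>

lemma transfer1_coeffs:
  "coeff (fst (transfer1 \<alpha> n)) n = 1" "\<And>k. k > n \<Longrightarrow> coeff (fst (transfer1 \<alpha> n)) k = 0"
  "\<And>k. k > n \<Longrightarrow> coeff (snd (transfer1 \<alpha> n)) k = 0"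
  "coeff (snd (transfer1 \<alpha> n)) 0 = 0" "n > 0 \<Longrightarrow> coeff (fst (transfer1 \<alpha> n)) 0 = 0"
proof (induction n)
  case (Suc n)
  { case 1 show ?case using Suc(1,3) by (simp add: Let_def split_beta) }
  { case 2 then show ?case using Suc(2,3) by (cases k) (simp_all add: Let_def split_beta) }
  { case 3 then show ?case using Suc(2,3) by (cases k) (simp_all add: Let_def split_beta) }
  { case 4 show ?case using Suc(4) by (simp add: Let_def split_beta) }
  { case 5 show ?case using Suc(4) by (simp add: Let_def split_beta) }
qed simp_all

text \<open>For positive \<open>n\<close> these degrees stay below \<open>n\<close>, so the top
  coefficient of the trace comes from \<open>transfer1\<close> alone and its constant one from
  \<open>transfer2\<close> alone. The condition \<open>k > 0\<close> matters only for
  \<open>n = 0\<close>, where the entry is the constant 1.\<close>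

lemma transfer2_coeffs:
  "\<And>k. k \<ge> n \<Longrightarrow> coeff (fst (transfer2 \<alpha> n)) k = 0"
  "\<And>k. k \<ge> n \<Longrightarrow> k > 0 \<Longrightarrow> coeff (snd (transfer2 \<alpha> n)) k = 0"
  "coeff (snd (transfer2 \<alpha> n)) 0 = 1"
proof (induction n)
  case (Suc n)
  { case 1 then show ?case using Suc(1,2) by (cases k) (simp_all add: Let_def split_beta) }
  { case 2 then show ?case using Suc(1,2) by (cases k) (simp_all add: Let_def split_beta) }
  { case 3 show ?case using Suc(3) by (simp add: Let_def split_beta) }
qed (simp_all add: coeff_eq_0)

lemma transfer_trace_coeffs:
  assumes "n > 0"
  shows "degree (transfer_trace \<alpha> n) \<le> n" "coeff (transfer_trace \<alpha> n) 0 = 1"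
    "coeff (transfer_trace \<alpha> n) n = 1"
  using assms by (auto simp: transfer_trace_def transfer1_coeffs transfer2_coeffs intro!: degree_le)

text \<open>Determinants multiply, and the step with coefficient \<open>\<alpha> n\<close>
  contributes the factor \<open>(1 - |\<alpha> n|\<^sup>2) z\<close>.\<close>

lemma transfer_det_eq:
  "poly (transfer_det \<alpha> n) z = of_real (\<Prod>j<n. 1 - (cmod (\<alpha> j))\<^sup>2) * z ^ n"
proof (induction n)
  case (Suc n)
  have "poly (transfer_det \<alpha> (Suc n)) z = (1 - \<alpha> n * cnj (\<alpha> n)) * z * poly (transfer_det \<alpha> n) z"
    by (simp add: transfer_det_def Let_def split_beta algebra_simps)
  also have "1 - \<alpha> n * cnj (\<alpha> n) = of_real (1 - (cmod (\<alpha> n))\<^sup>2)"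
    by (simp only: complex_norm_square[symmetric] of_real_diff of_real_1 of_real_power)
  finally show ?case using Suc by (simp add: algebra_simps)
qed (simp add: transfer_det_def)

text \<open>Arbitrary sequences are allowed so that the recursion can be restarted at any multiple
  of the period.\<close>

lemma transfer_action:
  fixes X Y :: "nat \<Rightarrow> complex"
  assumes "\<And>n. X (Suc n) = z * X n - cnj (\<alpha> n) * Y n"
    and "\<And>n. Y (Suc n) = Y n - \<alpha> n * z * X n"
  shows "X n = poly (fst (transfer1 \<alpha> n)) z * X 0 + poly (fst (transfer2 \<alpha> n)) z * Y 0
       \<and> Y n = poly (snd (transfer1 \<alpha> n)) z * X 0 + poly (snd (transfer2 \<alpha> n)) z * Y 0"
  by (induction n) (simp_all add: assms Let_def split_beta algebra_simps)

text \<open>By periodicity each block of \<open>p\<close> steps applies the same 2 by 2 matrix. By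
  Cayley-Hamilton every linear functional of the orbit obeys the recurrence given by its trace and
  determinant; the difference is chosen because it vanishes at the start for orthogonal
  polynomials.\<close>

lemma periodic_cayley_hamilton:
  fixes X Y :: "nat \<Rightarrow> complex"
  assumes X: "\<And>n. X (Suc n) = z * X n - cnj (\<alpha> n) * Y n"
    and Y: "\<And>n. Y (Suc n) = Y n - \<alpha> n * z * X n"
    and per: "\<And>j. \<alpha> (j + p) = \<alpha> j"
  defines "w \<equiv> \<lambda>k. X (k * p) - Y (k * p)"
  shows "w (Suc (Suc k)) = poly (transfer_trace \<alpha> p) z * w (Suc k) - poly (transfer_det \<alpha> p) z * w k"
proof -
  have per': "\<alpha> (k * p + j) = \<alpha> j" for k j
  proof (induction k)
    case (Suc k)
    have "\<alpha> (Suc k * p + j) = \<alpha> (k * p + j + p)" by (simp add: add_ac)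
    then show ?case using Suc per by simp
  qed simp
  define a b c e where "a = poly (fst (transfer1 \<alpha> p)) z" and "b = poly (fst (transfer2 \<alpha> p)) z"
    and "c = poly (snd (transfer1 \<alpha> p)) z" and "e = poly (snd (transfer2 \<alpha> p)) z"
  have step: "X (Suc k * p) = a * X (k * p) + b * Y (k * p)"
    "Y (Suc k * p) = c * X (k * p) + e * Y (k * p)" for k
  proof -
    have "X (k * p + Suc n) = z * X (k * p + n) - cnj (\<alpha> n) * Y (k * p + n)"
      "Y (k * p + Suc n) = Y (k * p + n) - \<alpha> n * z * X (k * p + n)" for n
      using X[of "k * p + n"] Y[of "k * p + n"] per' by simp_all
    from transfer_action[of "\<lambda>n. X (k * p + n)", OF this, of p]
    show "X (Suc k * p) = a * X (k * p) + b * Y (k * p)"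
      "Y (Suc k * p) = c * X (k * p) + e * Y (k * p)"
      by (simp_all add: a_def b_def c_def e_def add.commute)
  qed
  show ?thesis
    unfolding w_def step transfer_trace_def transfer_det_def poly_add poly_diff poly_mult
      a_def[symmetric] b_def[symmetric] c_def[symmetric] e_def[symmetric]
    by algebra
qed

section \<open>Inner products on the circle and reversed polynomials\<close>

lemma cnj_mult_self_eq: "cnj z * z = of_real ((cmod z)\<^sup>2)"
  using complex_norm_square[of z] by (simp add: mult.commute)

lemma poly_inner_self:
  "poly_inner \<mu> P P = of_real (LINT z|\<mu>. (cmod (poly P z))\<^sup>2)"
  by (simp only: poly_inner_def cnj_mult_self_eq integral_complex_of_real)

lemma integrable_cmod_poly_square:
  assumes "circle_prob_measure \<mu>"
  shows "integrable \<mu> (\<lambda>z. (cmod (poly P z))\<^sup>2)"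
  using integrable_Re[OF poly_inner_integrable[OF assms, of P P]]
  by (simp only: cnj_mult_self_eq Re_complex_of_real)

lemma poly_inner_cong:
  assumes "circle_prob_measure \<mu>"
    and "\<And>z. cmod z = 1 \<Longrightarrow> cnj (poly P z) * poly Q z = cnj (poly P' z) * poly Q' z"
  shows "poly_inner \<mu> P Q = poly_inner \<mu> P' Q'"
  unfolding poly_inner_def
  using assms circle_prob_measure_space[OF assms(1)] by (intro Bochner_Integration.integral_cong) auto

lemma poly_inner_shift:
  assumes "circle_prob_measure \<mu>"
  shows "poly_inner \<mu> (pCons 0 P) (pCons 0 Q) = poly_inner \<mu> P Q"
proof (rule poly_inner_cong[OF assms])
  fix z :: complex assume "cmod z = 1"
  then have "cnj z * z = 1" using complex_norm_square[of z] by (simp add: mult.commute)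
  then show "cnj (poly (pCons 0 P) z) * poly (pCons 0 Q) z = cnj (poly P z) * poly Q z"
    by (simp add: algebra_simps)
qed

lemma poly_inner_commute: "poly_inner \<mu> P Q = cnj (poly_inner \<mu> Q P)"
  unfolding poly_inner_def by (simp add: mult.commute flip: Bochner_Integration.integral_cnj)

text \<open>\<open>szego_dual P\<close> is the reversed polynomial \<open>P\<^sup>*(z) = z\<^sup>n cnj (P (1 / cnj z))\<close> with \<open>n = degree P\<close>.\<close>

definition szego_dual :: "complex poly \<Rightarrow> complex poly" where
  "szego_dual P = reflect_poly (map_poly cnj P)"

lemma degree_map_poly_cnj: "degree (map_poly cnj P) = degree P"
  by (rule degree_map_poly) auto

lemma coeff_szego_dual:
  "coeff (szego_dual P) k = (if k > degree P then 0 else cnj (coeff P (degree P - k)))"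
  by (simp add: szego_dual_def coeff_reflect_poly degree_map_poly_cnj coeff_map_poly)

lemma poly_szego_dual:
  assumes "cmod z = 1"
  shows "poly (szego_dual P) z = z ^ degree P * cnj (poly P z)"
proof -
  have z: "z * cnj z = 1" using assms complex_norm_square[of z] by simp
  then have "inverse z = cnj z" by (rule inverse_unique)
  moreover have "z \<noteq> 0" using assms by auto
  ultimately show ?thesis
    by (simp add: szego_dual_def poly_reflect_poly_nz degree_map_poly_cnj)
qed

section \<open>Szego recursion and norms of the orthogonal polynomials\<close>

locale nontrivial_circle_measure =
  fixes \<mu> :: "complex measure"
  assumes circle: "circle_prob_measure \<mu>" and nontrivial: "\<not> finite_delta_combination \<mu>"
begin

abbreviation "\<Phi> \<equiv> monic_OP \<mu>"

lemma OP:
  "degree (\<Phi> n) = n" "coeff (\<Phi> n) n = 1" "j < n \<Longrightarrow> poly_inner \<mu> (monom 1 j) (\<Phi> n) = 0"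
  using is_monic_OP_monic_OP[OF circle nontrivial, of n] by (auto simp: is_monic_OP_def)

text \<open>On the circle, reversal turns the pairing with \<open>z^j\<close> into the pairing of
  \<open>\<Phi> n\<close> with \<open>z^(n-j)\<close>, and \<open>n - j < n\<close> since
  \<open>j \<ge> 1\<close>.\<close>

lemma dual_OP_orthogonal:
  assumes "1 \<le> j" "j \<le> n"
  shows "poly_inner \<mu> (monom 1 j) (szego_dual (\<Phi> n)) = 0"
proof -
  have "poly_inner \<mu> (monom 1 j) (szego_dual (\<Phi> n)) = poly_inner \<mu> (\<Phi> n) (monom 1 (n - j))"
  proof (rule poly_inner_cong[OF circle])
    fix z :: complex assume z: "cmod z = 1"
    have "cnj z ^ j * z ^ n = (cnj z * z) ^ j * z ^ (n - j)"
      using assms by (simp add: power_mult_distrib flip: power_add)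
    also have "cnj z * z = 1" using z complex_norm_square[of z] by (simp add: mult.commute)
    finally have eq: "cnj z ^ j * z ^ n = z ^ (n - j)" by simp
    have "cnj (poly (monom 1 j) z) * poly (szego_dual (\<Phi> n)) z
        = (cnj z ^ j * z ^ n) * cnj (poly (\<Phi> n) z)"
      by (simp add: poly_szego_dual[OF z] OP poly_monom)
    then show "cnj (poly (monom 1 j) z) * poly (szego_dual (\<Phi> n)) z
        = cnj (poly (\<Phi> n) z) * poly (monom 1 (n - j)) z"
      unfolding eq by (simp add: poly_monom)
  qed
  also have "\<dots> = 0"
    using assms by (subst poly_inner_commute) (simp add: OP)
  finally show ?thesis .
qed

text \<open>The defect \<open>Q\<close> vanishes at 0 by the definition of
  \<open>verblunsky\<close>, has degree at most \<open>n\<close>, and is orthogonal to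
  \<open>z, ..., z^n\<close>. Hence \<open>Q / z\<close> has degree below \<open>n\<close> and is
  orthogonal to itself.\<close>

lemma szego_recursion:
  "\<Phi> (Suc n) = pCons 0 (\<Phi> n) - smult (cnj (verblunsky \<mu> n)) (szego_dual (\<Phi> n))"
proof -
  define \<beta> where "\<beta> = cnj (verblunsky \<mu> n)"
  define Q where "Q = \<Phi> (Suc n) - pCons 0 (\<Phi> n) + smult \<beta> (szego_dual (\<Phi> n))"
  have "coeff Q 0 = 0"
    by (simp add: Q_def \<beta>_def verblunsky_def coeff_szego_dual OP poly_0_coeff_0)
  then obtain S where S: "Q = pCons 0 S" by (metis coeff_pCons_0 pCons_cases)
  have "poly_inner \<mu> (monom 1 j) S = 0" if "j < n" for j
  proof -
    have sh: "monom 1 (Suc j) = pCons 0 (monom (1::complex) j)" by (rule monom_Suc)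
    have "poly_inner \<mu> (monom 1 j) S = poly_inner \<mu> (monom 1 (Suc j)) Q"
      by (simp add: S sh poly_inner_shift[OF circle])
    also have "poly_inner \<mu> (monom 1 (Suc j)) (pCons 0 (\<Phi> n)) = 0"
      using that by (simp add: sh poly_inner_shift[OF circle] OP)
    then have "poly_inner \<mu> (monom 1 (Suc j)) Q = 0"
      unfolding Q_def using that OP(3)[of "Suc j" "Suc n"] dual_OP_orthogonal[of "Suc j" n]
      by (simp add: poly_inner_linear[OF circle])
    finally show ?thesis .
  qed
  moreover have "coeff S j = 0" if "j \<ge> n" for j
  proof -
    have "coeff Q (Suc j) = 0"
      using that OP(1,2)[of n] OP(1,2)[of "Suc n"]
      by (cases "j = n") (auto simp: Q_def coeff_szego_dual coeff_eq_0)
    then show ?thesis by (simp add: S)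
  qed
  ultimately have "poly_inner \<mu> S S = 0"
    by (intro poly_inner_orthogonal_low_degree[OF circle, of n]) auto
  then have "S = 0" by (rule poly_inner_self_eq_0[OF circle nontrivial])
  then show ?thesis
    using S by (simp add: Q_def \<beta>_def eq_diff_eq diff_add_eq)
qed

text \<open>Pythagoras for the recursion: the reversed polynomial has degree at most
  \<open>n\<close>, hence is orthogonal to \<open>\<Phi> (Suc n)\<close>, while reversal and
  multiplication by \<open>z\<close> preserve the norm.\<close>

lemma OP_norm_square:
  "(LINT z|\<mu>. (cmod (poly (\<Phi> n) z))\<^sup>2) = (\<Prod>j<n. 1 - (cmod (verblunsky \<mu> j))\<^sup>2)"
proof (induction n)
  case 0
  interpret prob_space \<mu> using circle by (simp add: circle_prob_measure_def)
  have "\<Phi> 0 = 1" using OP(1,2)[of 0] by (metis degree_eq_zeroE coeff_pCons_0 one_pCons)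
  then show ?case by (simp add: prob_space)
next
  case (Suc n)
  define a where "a = verblunsky \<mu> n"
  define D where "D = szego_dual (\<Phi> n)"
  have eq: "pCons 0 (\<Phi> n) = \<Phi> (Suc n) + smult (cnj a) D"
    using szego_recursion[of n] by (simp add: a_def D_def)
  have orth: "poly_inner \<mu> D (\<Phi> (Suc n)) = 0"
    by (rule poly_inner_orthogonal_low_degree[OF circle, of "Suc n"])
       (auto simp: OP D_def coeff_szego_dual)
  then have orth': "poly_inner \<mu> (\<Phi> (Suc n)) D = 0"
    by (subst poly_inner_commute) simp
  have D: "poly_inner \<mu> D D = poly_inner \<mu> (\<Phi> n) (\<Phi> n)"
  proof (rule poly_inner_cong[OF circle])
    fix z :: complex assume z: "cmod z = 1"
    have "cnj (z ^ n) * z ^ n = 1"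
      using z complex_norm_square[of "z ^ n"] by (simp add: norm_power mult.commute)
    then show "cnj (poly D z) * poly D z = cnj (poly (\<Phi> n) z) * poly (\<Phi> n) z"
      by (simp add: D_def poly_szego_dual[OF z] OP algebra_simps)
  qed
  have "poly_inner \<mu> (\<Phi> n) (\<Phi> n) = poly_inner \<mu> (pCons 0 (\<Phi> n)) (pCons 0 (\<Phi> n))"
    by (simp add: poly_inner_shift[OF circle])
  also have "\<dots> = poly_inner \<mu> (\<Phi> (Suc n)) (\<Phi> (Suc n)) + a * cnj a * poly_inner \<mu> (\<Phi> n) (\<Phi> n)"
    unfolding eq by (simp add: poly_inner_linear[OF circle] orth orth' D)
  finally have "poly_inner \<mu> (\<Phi> (Suc n)) (\<Phi> (Suc n))
      = (1 - a * cnj a) * poly_inner \<mu> (\<Phi> n) (\<Phi> n)"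
    by (simp add: algebra_simps)
  also have "1 - a * cnj a = of_real (1 - (cmod a)\<^sup>2)"
    by (simp only: complex_norm_square of_real_diff of_real_1)
  finally have "poly_inner \<mu> (\<Phi> (Suc n)) (\<Phi> (Suc n))
      = of_real (1 - (cmod a)\<^sup>2) * poly_inner \<mu> (\<Phi> n) (\<Phi> n)" .
  then show ?case
    unfolding poly_inner_self Suc of_real_mult[symmetric] of_real_eq_iff by (simp add: a_def)
qed

end

section \<open>Pointwise growth on an arc against decay of the norms\<close>

theorem theorem5p4:
  fixes \<alpha> :: "nat \<Rightarrow> complex" and \<mu> :: "complex measure" and p :: nat
  assumes "circle_prob_measure \<mu>"
    and "\<not> finite_delta_combination \<mu>"
    and "\<And>j. \<alpha> j \<in> ball 0 1"
    and "p > 0"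
    and "\<And>j. \<alpha> (j + p) = \<alpha> j"
    and "\<And>j. verblunsky \<mu> j = \<alpha> j"
    and "measure_support \<mu> = sphere 0 1"
  shows "\<forall>j. \<alpha> j = 0"
proof (rule ccontr)
  assume "\<not> ?thesis"
  then obtain i where i: "\<alpha> i \<noteq> 0" by blast
  interpret nontrivial_circle_measure \<mu> using assms(1,2) by unfold_locales
  interpret prob_space \<mu> using circle by (simp add: circle_prob_measure_def)
  have sp: "space \<mu> = sphere 0 1" by (rule circle_prob_measure_space[OF circle])
  have V: "verblunsky \<mu> = \<alpha>" using assms(6) by blast
  have \<alpha>1: "cmod (\<alpha> j) < 1" for j using assms(3)[of j] by simp
  have per: "\<alpha> (j + k * p) = \<alpha> j" for j k
  proof (induction k)
    case (Suc k)
    then show ?case using assms(5)[of "j + k * p"] by (simp add: add_ac)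
  qed simp
  define S where "S = (\<Prod>j<p. 1 - (cmod (\<alpha> j))\<^sup>2)"
  have fac: "0 < 1 - (cmod (\<alpha> j))\<^sup>2" "1 - (cmod (\<alpha> j))\<^sup>2 \<le> 1" for j
    using \<alpha>1[of j] by (simp_all add: power_less_one_iff)
  have S0: "S > 0" unfolding S_def by (intro prod_pos) (use fac in auto)
  have i': "\<alpha> (i mod p) \<noteq> 0" using i per[of "i mod p" "i div p"] by simp
  have "S = (1 - (cmod (\<alpha> (i mod p)))\<^sup>2) * (\<Prod>j\<in>{..<p} - {i mod p}. 1 - (cmod (\<alpha> j))\<^sup>2)"
    unfolding S_def using \<open>p > 0\<close> by (intro prod.remove) auto
  also have "\<dots> \<le> (1 - (cmod (\<alpha> (i mod p)))\<^sup>2) * 1"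
    using fac by (intro mult_left_mono prod_le_1) (auto intro: less_imp_le)
  also have "\<dots> < 1" using i' by simp
  finally have S1: "S < 1" .
  define R where "R = sqrt S"
  have R: "0 < R" "R < 1" "R\<^sup>2 = S" using S0 S1 by (simp_all add: R_def)
  define t where "t = transfer_trace \<alpha> p"
  define W where "W = \<Phi> p - szego_dual (\<Phi> p)"
  obtain \<zeta> where \<zeta>: "cmod \<zeta> = 1" "2 \<le> cmod (poly t \<zeta>)"
    using exists_unit_circle_large_poly[of p t] transfer_trace_coeffs[OF \<open>p > 0\<close>, of \<alpha>] \<open>p > 0\<close>
    unfolding t_def by auto
  \<comment> \<open>With this choice \<open>2 * R + \<epsilon> = 1 + R\<close> lies strictly between
    \<open>2 * R\<close> and 2, and the growth rate \<open>R + \<epsilon>\<close> is exactly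
    1.\<close>
  define \<epsilon> where "\<epsilon> = 1 - R"
  have \<epsilon>: "\<epsilon> > 0" "2 * R + \<epsilon> < 2" using R by (simp_all add: \<epsilon>_def)
  define U where "U = {z. 2 * R + \<epsilon> < cmod (poly t z)}"
  have "open U" unfolding U_def by (intro open_Collect_less continuous_intros)
  obtain m where m: "p = Suc m" using \<open>p > 0\<close> by (cases p) auto
  \<comment> \<open>\<open>W\<close> is the value \<open>w 1\<close> that starts the growth below;
    its constant term is nonzero because \<open>|\<alpha> m| < 1\<close>.\<close>
  have "coeff W 0 = - cnj (\<alpha> m) - 1"
    using arg_cong[OF V, of "\<lambda>f. cnj (f m)"]
    by (simp add: W_def coeff_szego_dual OP verblunsky_def m poly_0_coeff_0)
       (metis minus_minus)
  moreover have "- cnj (\<alpha> m) \<noteq> 1"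
    using \<alpha>1[of m] by (metis complex_mod_cnj less_irrefl norm_minus_cancel norm_one)
  ultimately have "W \<noteq> 0" by auto
  then have finW: "finite {z. poly W z = 0}" by (rule poly_roots_finite)
  \<comment> \<open>A connected set with more than one point has no isolated points, so the open set
    \<open>U\<close> meets the circle in infinitely many points and is not exhausted by the zeros of
    \<open>W\<close>.\<close>
  have "sphere 0 1 \<noteq> {x}" for x :: complex
  proof
    assume "sphere 0 1 = {x}"
    moreover have "1 \<in> sphere (0::complex) 1" "- 1 \<in> sphere (0::complex) 1" by simp_all
    ultimately have "1 = (- 1 :: complex)" by (metis singletonD)
    then show False by simp
  qed
  then have "\<zeta> islimpt sphere 0 1"
    using \<zeta> by (intro connected_imp_perfect connected_sphere) auto
  moreover have "\<zeta> \<in> sphere 0 1 \<inter> U" using \<zeta> \<epsilon> by (simp add: U_def)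
  ultimately have "infinite (sphere 0 1 \<inter> U)"
    using \<open>open U\<close> infinite_openin openin_open_Int by blast
  then have "\<not> sphere 0 1 \<inter> U \<subseteq> {z. poly W z = 0}" using finW finite_subset by blast
  then obtain z0 where z0: "z0 \<in> sphere 0 1" "z0 \<in> U" "poly W z0 \<noteq> 0" by blast
  \<comment> \<open>Halving the value at \<open>z0\<close> leaves room for a neighbourhood
    \<open>N\<close> on which \<open>|W|\<^sup>2\<close> is bounded below by
    \<open>c\<close>.\<close>
  define c where "c = (cmod (poly W z0) / 2)\<^sup>2"
  have c0: "c > 0" using z0 by (simp add: c_def)
  define N where "N = U \<inter> {z. cmod (poly W z0) / 2 < cmod (poly W z)}"
  have "open N" unfolding N_def using \<open>open U\<close>
    by (intro open_Int open_Collect_less continuous_intros)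
  have "z0 \<in> N" using z0 by (simp add: N_def)
  define A where "A = N \<inter> space \<mu>"
  have "z0 \<in> measure_support \<mu>" using z0 assms(7) by simp
  then have "emeasure \<mu> A > 0"
    using \<open>open N\<close> \<open>z0 \<in> N\<close> by (simp add: measure_support_def A_def)
  then have A0: "measure \<mu> A > 0"
    by (simp add: emeasure_eq_measure)
  have Asets: "A \<in> sets \<mu>"
    using circle \<open>open N\<close> unfolding A_def sp
    by (auto simp: circle_prob_measure_def sets_restrict_space image_iff Int_commute
        intro!: bexI[of _ N])
  define n where "n k z = (cmod (poly (\<Phi> (k * p)) z))\<^sup>2" for k z
  have int_n: "integrable \<mu> (n k)" for k
    unfolding n_def by (rule integrable_cmod_poly_square[OF circle])
  have LINT_n: "(LINT z|\<mu>. n k z) = S ^ k" for k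
  proof -
    have prod_split: "prod f {..<a + b} = prod f {..<a} * (\<Prod>j<b. f (a + j))"
      for f :: "nat \<Rightarrow> real" and a b
      by (induction b) (simp_all add: mult.assoc)
    have "(\<Prod>j<k * p. 1 - (cmod (\<alpha> j))\<^sup>2) = S ^ k"
    proof (induction k)
      case (Suc k)
      have "(\<Prod>j<Suc k * p. 1 - (cmod (\<alpha> j))\<^sup>2)
          = (\<Prod>j<k * p. 1 - (cmod (\<alpha> j))\<^sup>2) * (\<Prod>j<p. 1 - (cmod (\<alpha> (j + k * p)))\<^sup>2)"
        using prod_split[of "\<lambda>j. 1 - (cmod (\<alpha> j))\<^sup>2" "k * p" p] by (simp add: add.commute)
      then show ?case by (simp add: per S_def[symmetric] Suc mult.commute)
    qed simp
    then show ?thesis unfolding n_def OP_norm_square V .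
  qed
  have bound: "((R + \<epsilon>)\<^sup>2) ^ k * c * indicator A z \<le> 8 * n (Suc k) z + 8 * S * n k z"
    if "z \<in> space \<mu>" for k z
  proof (cases "z \<in> A")
    case True
    have z: "cmod z = 1" using that sp by simp
    define X where "X j = poly (\<Phi> j) z" for j
    define Y where "Y j = poly (szego_dual (\<Phi> j)) z" for j
    have Y: "Y j = z ^ j * cnj (X j)" for j
      by (simp add: X_def Y_def poly_szego_dual[OF z] OP)
    have zz: "z * cnj z = 1" using z complex_norm_square[of z] by simp
    have X1: "X (Suc j) = z * X j - cnj (\<alpha> j) * Y j" for j
      by (simp add: X_def Y_def szego_recursion V)
    \<comment> \<open>This is \<open>X1\<close> conjugated and multiplied by
      \<open>z ^ Suc j\<close>, using \<open>|z| = 1\<close>.\<close>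
    have Y1: "Y (Suc j) = Y j - \<alpha> j * z * X j" for j
    proof -
      have "z ^ j * cnj z ^ j = 1" by (simp add: zz flip: power_mult_distrib)
      moreover have "Y (Suc j) = (z * cnj z) * (z ^ j * cnj (X j)) - \<alpha> j * z * X j * (z ^ j * cnj z ^ j)"
        by (simp add: Y X1 algebra_simps)
      ultimately show ?thesis by (simp add: zz Y)
    qed
    have normY: "cmod (Y j) = cmod (X j)" for j by (simp add: Y norm_mult norm_power z)
    define w where "w k = X (k * p) - Y (k * p)" for k
    have wX: "cmod (w k) \<le> 2 * cmod (X (k * p))" for k
      using norm_triangle_ineq4[of "X (k * p)" "Y (k * p)"] by (simp add: w_def normY)
    have "(R + \<epsilon>) ^ k * cmod (w 1) \<le> cmod (w (Suc k)) + R * cmod (w k)"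
    proof (rule recurrence_growth[where t = "poly t z" and d = "poly (transfer_det \<alpha> p) z"])
      show "w 0 = 0" using OP(1,2)[of 0] by (simp add: w_def Y X_def)
         (metis complex_cnj_one degree_eq_zeroE coeff_pCons_0 one_pCons poly_1)
      show "w (Suc (Suc k)) = poly t z * w (Suc k) - poly (transfer_det \<alpha> p) z * w k" for k
        unfolding w_def t_def
        by (rule periodic_cayley_hamilton[of X z \<alpha> Y p, OF X1 Y1 assms(5)])
      show "cmod (poly (transfer_det \<alpha> p) z) = R\<^sup>2"
        using S0 by (simp add: transfer_det_eq norm_mult norm_power z R flip: S_def)
      show "2 * R + \<epsilon> \<le> cmod (poly t z)" using True by (simp add: A_def N_def U_def)
    qed (use R \<epsilon> in auto)
    also have "\<dots> \<le> 2 * cmod (X (Suc k * p)) + R * (2 * cmod (X (k * p)))"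
      using wX[of "Suc k"] wX[of k] R by (intro add_mono mult_left_mono) auto
    finally have "((R + \<epsilon>) ^ k * cmod (w 1))\<^sup>2 \<le> (2 * cmod (X (Suc k * p)) + 2 * R * cmod (X (k * p)))\<^sup>2"
      using R \<epsilon> by (intro power_mono) auto
    \<comment> \<open>The 8 is 2 from \<open>(a + b)\<^sup>2 \<le> 2 a\<^sup>2 + 2 b\<^sup>2\<close>
      times 4 from \<open>wX\<close>.\<close>
    also have "\<dots> \<le> 8 * (cmod (X (Suc k * p)))\<^sup>2 + 8 * R\<^sup>2 * (cmod (X (k * p)))\<^sup>2"
      using zero_le_power2[of "cmod (X (Suc k * p)) - R * cmod (X (k * p))"]
      by (simp add: power2_eq_square algebra_simps)
    finally have *: "((R + \<epsilon>)\<^sup>2) ^ k * (cmod (w 1))\<^sup>2 \<le> 8 * n (Suc k) z + 8 * S * n k z"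
      by (simp add: n_def X_def R power_mult_distrib mult.commute flip: power_mult)
    have "w 1 = poly W z" by (simp add: w_def X_def Y_def W_def)
    then have "c \<le> (cmod (w 1))\<^sup>2"
      using True unfolding c_def by (intro power_mono) (auto simp: A_def N_def)
    then have "((R + \<epsilon>)\<^sup>2) ^ k * c \<le> ((R + \<epsilon>)\<^sup>2) ^ k * (cmod (w 1))\<^sup>2"
      by (intro mult_left_mono) auto
    with * True show ?thesis by simp
  qed (use S0 in \<open>simp add: n_def\<close>)
  \<comment> \<open>Since \<open>R + \<epsilon> = 1\<close>, \<open>q\<close> equals
    \<open>S\<close> and is below 1. Both integrals on the right contribute
    \<open>8 * S * S ^ k\<close>, which gives the 16.\<close>
  define q where "q = S / (R + \<epsilon>)\<^sup>2"
  have "c * measure \<mu> A \<le> 16 * S * q ^ k" for k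
  proof -
    have "((R + \<epsilon>)\<^sup>2) ^ k * c * measure \<mu> A = (LINT z|\<mu>. ((R + \<epsilon>)\<^sup>2) ^ k * c * indicator A z)"
      using Asets sets.sets_into_space[OF Asets] by (simp add: Int_absorb2)
    also have "\<dots> \<le> (LINT z|\<mu>. 8 * n (Suc k) z + 8 * S * n k z)"
      using bound Asets int_n
      by (intro integral_mono integrable_mult_right integrable_real_indicator
            Bochner_Integration.integrable_add)
         (auto simp: emeasure_eq_measure)
    also have "\<dots> = 16 * S * S ^ k"
      using int_n by (simp add: LINT_n)
    finally show ?thesis using R \<epsilon> by (simp add: q_def power_divide field_simps)
  qed
  moreover have "(\<lambda>k. 16 * S * q ^ k) \<longlonglongrightarrow> 16 * S * 0"
    using S0 S1 by (intro tendsto_mult tendsto_const LIMSEQ_realpow_zero) (simp_all add: q_def \<epsilon>_def)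
  ultimately have "c * measure \<mu> A \<le> 16 * S * 0"
    by (intro LIMSEQ_le_const) auto
  with c0 A0 show False by (simp add: mult_le_0_iff)
qed

end
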